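(* Let $\mathbb{F}_q$ be a finite field with $q$ elements and let $L$ be a finite-dimensional non-abelian Lie algebra over $\mathbb{F}_q$ such that $\dim L/Z(L)=t$. Then $$d(L)\geq \frac{1}{q^{t}}+\frac{1}{q^{t-1}}-\frac{1}{q^{2t-1}}.$$
   Context: For a finite-dimensional Lie algebra $L$ over the finite field $\mathbb{F}_q$ (so $L$ is a finite set), the commutativity degree of $L$ is $d(L)=\dfrac{|\{(x,y)\in L\times L \mid [x,y]=0\}|}{|L|^{2}}$. Here $Z(L)=\{z\in L\mid [z,x]=0 \text{ for all } x\in L\}$ is the center of $L$. *)

theory Defs
  imports Complex_Main "HOL-Algebra.AbelCoset" "Jordan_Normal_Form.Missing_VectorSpace"
begin

text \<open>A Lie algebra is a vector space in the sense of \<^locale>\<open>vectorspace\<close> whose record carries an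
  additional bracket. The fields \<^const>\<open>mult\<close> and \<^const>\<open>one\<close>, which every module record inherits from
  the ring record, play no role.\<close>

record ('a, 'b) lie_alg = "('a, 'b) module" +
  lie_bracket :: "'b \<Rightarrow> 'b \<Rightarrow> 'b"

locale lie_algebra = vectorspace K L
  for K :: "('a, 'm) ring_scheme" and L :: "('a, 'b, 'n) lie_alg_scheme" +
  assumes bracket_closed:
      "\<lbrakk>x \<in> carrier L; y \<in> carrier L\<rbrakk> \<Longrightarrow> lie_bracket L x y \<in> carrier L"
    and bracket_add_left:
      "\<lbrakk>x \<in> carrier L; y \<in> carrier L; z \<in> carrier L\<rbrakk> \<Longrightarrow>
        lie_bracket L (x \<oplus>\<^bsub>L\<^esub> y) z = lie_bracket L x z \<oplus>\<^bsub>L\<^esub> lie_bracket L y z"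
    and bracket_add_right:
      "\<lbrakk>x \<in> carrier L; y \<in> carrier L; z \<in> carrier L\<rbrakk> \<Longrightarrow>
        lie_bracket L x (y \<oplus>\<^bsub>L\<^esub> z) = lie_bracket L x y \<oplus>\<^bsub>L\<^esub> lie_bracket L x z"
    and bracket_smult_left:
      "\<lbrakk>a \<in> carrier K; x \<in> carrier L; y \<in> carrier L\<rbrakk> \<Longrightarrow>
        lie_bracket L (a \<odot>\<^bsub>L\<^esub> x) y = a \<odot>\<^bsub>L\<^esub> lie_bracket L x y"
    and bracket_smult_right:
      "\<lbrakk>a \<in> carrier K; x \<in> carrier L; y \<in> carrier L\<rbrakk> \<Longrightarrow>
        lie_bracket L x (a \<odot>\<^bsub>L\<^esub> y) = a \<odot>\<^bsub>L\<^esub> lie_bracket L x y"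
    and bracket_self: "x \<in> carrier L \<Longrightarrow> lie_bracket L x x = \<zero>\<^bsub>L\<^esub>"
    and jacobi:
      "\<lbrakk>x \<in> carrier L; y \<in> carrier L; z \<in> carrier L\<rbrakk> \<Longrightarrow>
        lie_bracket L x (lie_bracket L y z) \<oplus>\<^bsub>L\<^esub> lie_bracket L y (lie_bracket L z x)
          \<oplus>\<^bsub>L\<^esub> lie_bracket L z (lie_bracket L x y) = \<zero>\<^bsub>L\<^esub>"

definition lie_abelian :: "('a, 'b, 'n) lie_alg_scheme \<Rightarrow> bool" where
  "lie_abelian L \<longleftrightarrow> (\<forall>x\<in>carrier L. \<forall>y\<in>carrier L. lie_bracket L x y = \<zero>\<^bsub>L\<^esub>)"

definition lie_center :: "('a, 'b, 'n) lie_alg_scheme \<Rightarrow> 'b set" where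
  "lie_center L = {z \<in> carrier L. \<forall>x\<in>carrier L. lie_bracket L z x = \<zero>\<^bsub>L\<^esub>}"

text \<open>This is meaningful only if the carrier is finite; otherwise \<^const>\<open>card\<close> returns \<open>0\<close>.\<close>

definition commutativity_degree :: "('a, 'b, 'n) lie_alg_scheme \<Rightarrow> real" where
  "commutativity_degree L =
     real (card {(x, y) \<in> carrier L \<times> carrier L. lie_bracket L x y = \<zero>\<^bsub>L\<^esub>})
       / real (card (carrier L)) ^ 2"

text \<open>The elements of the quotient by a subspace \<open>W\<close> are the cosets of \<open>W\<close>. The product of a scalar \<open>a\<close>
  with a coset \<open>X\<close> is the coset of \<open>a x\<close> for any \<open>x \<in> X\<close>; it is not the pointwise product
  \<open>{a x | x \<in> X}\<close>, which for \<open>a = 0\<close> is just \<open>{0}\<close>. The fields \<^const>\<open>mult\<close> and \<^const>\<open>one\<close> are dummies.\<close>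

definition quotient_space :: "('a, 'b, 'n) module_scheme \<Rightarrow> 'b set \<Rightarrow> ('a, 'b set) module" where
  "quotient_space V W =
     \<lparr>carrier = a_rcosets\<^bsub>V\<^esub> W,
      mult = (\<lambda>X Y. W),
      one = W,
      zero = W,
      add = (\<lambda>X Y. X <+>\<^bsub>V\<^esub> Y),
      smult = (\<lambda>a X. \<Union>x\<in>X. W +>\<^bsub>V\<^esub> (a \<odot>\<^bsub>V\<^esub> x))\<rparr>"

end

theory Submission
  imports Defs
begin

text \<open>Counting the commuting pairs by their first component, a central \<open>x\<close> contributes \<open>|L|\<close>, while
  the centralizer of a non-central \<open>x\<close> contains all elements \<open>a x + z\<close> with \<open>a\<close> a scalar and \<open>z\<close>
  central, which are pairwise distinct, so that \<open>x\<close> contributes at least \<open>q |Z(L)|\<close>. The bound follows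
  since \<open>|L| = q\<^sup>t |Z(L)|\<close>.\<close>

section \<open>Counting vectors by their coordinates\<close>

lemma (in vectorspace)
  assumes "fin_dim" and "finite (carrier K)"
  shows finite_carrier_if_fin_dim: "finite (carrier V)"
    and card_carrier_eq_power_dim: "card (carrier V) = card (carrier K) ^ dim"
proof -
  obtain B where B: "finite B" "basis B"
    using finite_basis_exists assms(1) by blast
  have sub: "B \<subseteq> carrier V"
    using B(2) by (simp add: basis_def)
  \<comment> \<open>Coordinates with respect to \<open>B\<close> are unique only among extensional
    functions, hence \<open>B \<rightarrow>\<^sub>E carrier K\<close>. Taking linear combinations
    then becomes a bijection, which gives finiteness and cardinality at once.\<close>
  have ex1: "\<forall>v. v \<in> carrier V \<longrightarrow> (\<exists>!a. a \<in> B \<rightarrow>\<^sub>E carrier K \<and> lincomb a B = v)"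
    using basis_criterion[OF B(1) sub] B(2) by simp
  have closed: "lincomb a B \<in> carrier V" if "a \<in> B \<rightarrow>\<^sub>E carrier K" for a
    using that sub by (intro lincomb_closed) auto
  have bij: "bij_betw (\<lambda>a. lincomb a B) (B \<rightarrow>\<^sub>E carrier K) (carrier V)"
    using ex1 closed by (intro bij_betwI') metis+
  have "finite (B \<rightarrow>\<^sub>E carrier K)"
    using B(1) assms(2) by (intro finite_PiE) auto
  then show "finite (carrier V)"
    using bij bij_betw_finite by blast
  have "card (carrier V) = card (B \<rightarrow>\<^sub>E carrier K)"
    using bij_betw_same_card[OF bij] by simp
  also have "\<dots> = card (carrier K) ^ dim"
    using B by (simp add: card_PiE dim_basis)
  finally show "card (carrier V) = card (carrier K) ^ dim" .
qed

section \<open>Cosets and quotient spaces\<close>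

context submodule
begin

text \<open>Closure under negation comes from closure under scalars, as -x = (-1) x. This opens up
  the theory of cosets, including Lagrange's theorem.\<close>

lemma abelian_subgroup: "abelian_subgroup N M"
proof -
  have "N \<noteq> {}"
    using zero_closed by blast
  interpret module R M by (rule module)
  have "\<ominus>\<^bsub>M\<^esub> x \<in> N" if "x \<in> N" for x
  proof -
    have "\<ominus>\<^bsub>M\<^esub> x = (\<ominus>\<^bsub>R\<^esub> \<one>\<^bsub>R\<^esub>) \<odot>\<^bsub>M\<^esub> x"
      using that subset by (auto simp: smult_minus_1)
    then show ?thesis
      using that by simp
  qed
  then have "subgroup N (add_monoid M)"
    using subset \<open>N \<noteq> {}\<close> by (intro add.subgroupI) (auto simp: a_inv_def)
  then show ?thesis
    by (intro abelian_subgroupI3 additive_subgroupI abelian_group_axioms)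
qed

text \<open>Two representatives of a coset differ by some n in \<open>N\<close>, and a n lies in
  \<open>N\<close> again. Hence all cosets in the union that defines the scalar product
  coincide.\<close>

lemma quotient_space_smult:
  assumes a: "a \<in> carrier R" and x: "x \<in> carrier M"
  shows "a \<odot>\<^bsub>quotient_space M N\<^esub> (N +>\<^bsub>M\<^esub> x) = N +>\<^bsub>M\<^esub> (a \<odot>\<^bsub>M\<^esub> x)"
proof -
  interpret module R M by (rule module)
  interpret N: abelian_subgroup N M by (rule abelian_subgroup)
  have "N +>\<^bsub>M\<^esub> (a \<odot>\<^bsub>M\<^esub> y) = N +>\<^bsub>M\<^esub> (a \<odot>\<^bsub>M\<^esub> x)" if y: "y \<in> N +>\<^bsub>M\<^esub> x" for y
  proof -
    obtain n where n: "n \<in> N" "y = n \<oplus>\<^bsub>M\<^esub> x"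
      using y by (auto simp: a_r_coset_def')
    have "a \<odot>\<^bsub>M\<^esub> y = a \<odot>\<^bsub>M\<^esub> n \<oplus>\<^bsub>M\<^esub> a \<odot>\<^bsub>M\<^esub> x"
      using n a x subset by (auto simp: smult_r_distr)
    then have "a \<odot>\<^bsub>M\<^esub> y \<in> N +>\<^bsub>M\<^esub> (a \<odot>\<^bsub>M\<^esub> x)"
      using n a by (auto simp: a_r_coset_def')
    then show ?thesis
      using N.a_repr_independence' a x by auto
  qed
  then have "(\<Union>y\<in>N +>\<^bsub>M\<^esub> x. N +>\<^bsub>M\<^esub> (a \<odot>\<^bsub>M\<^esub> y)) = (\<Union>y\<in>N +>\<^bsub>M\<^esub> x. N +>\<^bsub>M\<^esub> (a \<odot>\<^bsub>M\<^esub> x))"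
    by (rule SUP_cong[OF refl])
  \<comment> \<open>A constant union has the expected value only over a nonempty index set;
    \<open>x\<close> lies in its own coset.\<close>
  also have "\<dots> = N +>\<^bsub>M\<^esub> (a \<odot>\<^bsub>M\<^esub> x)"
    using N.a_rcos_self[OF x] unfolding UN_constant by (subst if_not_P) blast+
  finally show ?thesis
    unfolding quotient_space_def module.simps by simp
qed

end

context subspace
begin

text \<open>Every operation on cosets can be computed on representatives, so the vector space axioms
  pass from \<open>V\<close> to the quotient. That the quotient is a vector space is part of the
  claim.\<close>

lemma linear_map_quotient_space: "linear_map K V (quotient_space V W) (\<lambda>x. W +>\<^bsub>V\<^esub> x)"
proof -
  interpret vectorspace K V by (rule vs)
  interpret S: submodule K W V by (rule submod)
  interpret N: abelian_subgroup W V by (rule S.abelian_subgroup)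
  let ?Q = "quotient_space V W"
  have carr: "carrier ?Q = (\<lambda>x. W +>\<^bsub>V\<^esub> x) ` carrier V"
    by (auto simp: quotient_space_def A_RCOSETS_def')
  have zero: "\<zero>\<^bsub>?Q\<^esub> = W +>\<^bsub>V\<^esub> \<zero>\<^bsub>V\<^esub>"
    using N.a_subset by (simp add: quotient_space_def a_coset_add_zero)
  have add: "(W +>\<^bsub>V\<^esub> x) \<oplus>\<^bsub>?Q\<^esub> (W +>\<^bsub>V\<^esub> y) = W +>\<^bsub>V\<^esub> (x \<oplus>\<^bsub>V\<^esub> y)"
    if "x \<in> carrier V" "y \<in> carrier V" for x y
    using that by (simp add: quotient_space_def N.a_rcos_sum)
  note smult = S.quotient_space_smult
  have "vectorspace K ?Q"
  proof (rule vs_criteria)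
    show "field K" by unfold_locales
    show "\<forall>v\<in>carrier ?Q. \<exists>w\<in>carrier ?Q. v \<oplus>\<^bsub>?Q\<^esub> w = \<zero>\<^bsub>?Q\<^esub>"
      by (auto simp: carr zero add r_neg intro!: bexI[of _ "\<ominus>\<^bsub>V\<^esub> _"])
  qed (auto simp: carr zero add smult a_ac smult_assoc1 smult_l_distr smult_r_distr)
  then interpret Q: vectorspace K ?Q .
  show ?thesis
    by unfold_locales (auto simp: module_hom_def carr add smult)
qed

text \<open>Lagrange's theorem, with the number of cosets found by counting coordinates in the
  quotient.\<close>

lemma card_carrier_eq_card_mult_power_dim:
  assumes fd: "vectorspace.fin_dim K V" and fin: "finite (carrier K)"
  shows "card (carrier V) = card W * card (carrier K) ^ vectorspace.dim K (quotient_space V W)"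
proof -
  interpret S: submodule K W V by (rule submod)
  interpret N: abelian_subgroup W V by (rule S.abelian_subgroup)
  interpret T: linear_map K V "quotient_space V W" "\<lambda>x. W +>\<^bsub>V\<^esub> x"
    by (rule linear_map_quotient_space)
  have carr: "carrier (quotient_space V W) = a_rcosets\<^bsub>V\<^esub> W"
    by (simp add: quotient_space_def)
  \<comment> \<open>The projection is onto, so finite dimension carries over from
    \<open>V\<close>.\<close>
  have "T.W.fin_dim"
    using T.rank_nullity_main(2)[OF fd] by (auto simp: carr A_RCOSETS_def')
  then have "card (a_rcosets\<^bsub>V\<^esub> W) = card (carrier K) ^ T.W.dim"
    using T.W.card_carrier_eq_power_dim fin by (simp add: carr)
  moreover have "card (a_rcosets\<^bsub>V\<^esub> W) * card W = card (carrier V)"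
    using N.a_lagrange[OF T.V.finite_carrier_if_fin_dim[OF fd fin]] N.is_additive_subgroup
    by (simp add: order_def)
  ultimately show ?thesis
    by (simp add: mult.commute)
qed

end

section \<open>Center, centralizers and commuting pairs\<close>

context lie_algebra
begin

lemma bracket_zero_left: "x \<in> carrier L \<Longrightarrow> lie_bracket L \<zero>\<^bsub>L\<^esub> x = \<zero>\<^bsub>L\<^esub>"
  using bracket_smult_left[of "\<zero>\<^bsub>K\<^esub>" "\<zero>\<^bsub>L\<^esub>" x] bracket_closed[of "\<zero>\<^bsub>L\<^esub>" x] by simp

text \<open>Polarization: expand [x + y, x + y] = 0 and drop the squares [x, x] and [y, y].\<close>

lemma bracket_anticomm:
  assumes "x \<in> carrier L" "y \<in> carrier L"
  shows "lie_bracket L x y \<oplus>\<^bsub>L\<^esub> lie_bracket L y x = \<zero>\<^bsub>L\<^esub>"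
proof -
  have "\<zero>\<^bsub>L\<^esub> = lie_bracket L (x \<oplus>\<^bsub>L\<^esub> y) (x \<oplus>\<^bsub>L\<^esub> y)"
    using assms by (simp add: bracket_self)
  also have "\<dots> = lie_bracket L x (x \<oplus>\<^bsub>L\<^esub> y) \<oplus>\<^bsub>L\<^esub> lie_bracket L y (x \<oplus>\<^bsub>L\<^esub> y)"
    using assms by (intro bracket_add_left) auto
  also have "\<dots> = lie_bracket L x y \<oplus>\<^bsub>L\<^esub> lie_bracket L y x"
    using assms by (simp add: bracket_add_right bracket_closed bracket_self)
  finally show ?thesis by simp
qed

text \<open>The center is defined with its elements on the left of the bracket, whereas the
  centralizers below have theirs on the right.\<close>

lemma bracket_eq_zero_commute:
  assumes "x \<in> carrier L" "y \<in> carrier L" "lie_bracket L x y = \<zero>\<^bsub>L\<^esub>"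
  shows "lie_bracket L y x = \<zero>\<^bsub>L\<^esub>"
  using bracket_anticomm[OF assms(1,2)] assms bracket_closed[of y x] by simp

lemma subspace_lie_center: "subspace K (lie_center L) L"
proof (rule subspace.intro)
  show "vectorspace K L" by unfold_locales
  show "submodule K (lie_center L) L"
    by unfold_locales (auto simp: lie_center_def bracket_add_left bracket_smult_left bracket_zero_left)
qed

lemma card_centralizer_ge:
  assumes fin: "finite (carrier L)" and x: "x \<in> carrier L" "x \<notin> lie_center L"
  shows "card (carrier K) * card (lie_center L) \<le> card {y \<in> carrier L. lie_bracket L x y = \<zero>\<^bsub>L\<^esub>}"
proof -
  interpret S: subspace K "lie_center L" L by (rule subspace_lie_center)
  interpret S: submodule K "lie_center L" L by (rule S.submod)
  interpret Z: abelian_subgroup "lie_center L" L by (rule S.abelian_subgroup)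
  let ?Z = "lie_center L" and ?f = "\<lambda>(a, z). a \<odot>\<^bsub>L\<^esub> x \<oplus>\<^bsub>L\<^esub> z"
  have "inj_on ?f (carrier K \<times> ?Z)"
  proof (rule inj_onI, clarify)
    fix a z b w
    assume ab: "a \<in> carrier K" "b \<in> carrier K" and zw: "z \<in> ?Z" "w \<in> ?Z"
      and eq: "a \<odot>\<^bsub>L\<^esub> x \<oplus>\<^bsub>L\<^esub> z = b \<odot>\<^bsub>L\<^esub> x \<oplus>\<^bsub>L\<^esub> w"
    have zw': "z \<in> carrier L" "w \<in> carrier L"
      using zw S.subset by auto
    show "a = b \<and> z = w"
    proof (cases "a = b")
      case True
      then show ?thesis
        using eq ab x zw' by simp
    next
      case False
      \<comment> \<open>If a and b differ, then (a - b) x = w - z is central. Dividing by the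
        nonzero scalar a - b makes x central, a contradiction.\<close>
      let ?c = "a \<ominus>\<^bsub>K\<^esub> b"
      have c: "?c \<in> carrier K" "?c \<noteq> \<zero>\<^bsub>K\<^esub>"
        using ab False by auto
      have "a \<odot>\<^bsub>L\<^esub> x = (a \<odot>\<^bsub>L\<^esub> x \<oplus>\<^bsub>L\<^esub> z) \<oplus>\<^bsub>L\<^esub> \<ominus>\<^bsub>L\<^esub> z"
        using ab x zw' by (simp add: a_assoc r_neg)
      then have "?c \<odot>\<^bsub>L\<^esub> x = (b \<odot>\<^bsub>L\<^esub> x \<oplus>\<^bsub>L\<^esub> w \<oplus>\<^bsub>L\<^esub> \<ominus>\<^bsub>L\<^esub> z) \<oplus>\<^bsub>L\<^esub> \<ominus>\<^bsub>L\<^esub> (b \<odot>\<^bsub>L\<^esub> x)"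
        using ab x by (simp add: eq a_minus_def smult_l_distr smult_l_minus)
      also have "\<dots> = w \<oplus>\<^bsub>L\<^esub> \<ominus>\<^bsub>L\<^esub> z"
        using ab x zw' by (simp add: a_ac r_neg r_neg1)
      finally have "?c \<odot>\<^bsub>L\<^esub> x \<in> ?Z"
        using zw by simp
      then have "inv\<^bsub>K\<^esub> ?c \<odot>\<^bsub>L\<^esub> (?c \<odot>\<^bsub>L\<^esub> x) \<in> ?Z"
        using c by (auto simp: field_Units intro!: S.smult_closed[of "inv\<^bsub>K\<^esub> ?c" "?c \<odot>\<^bsub>L\<^esub> x"])
      then show ?thesis
        using mult_inverse[OF c(1) x(1) refl c(2)] x(2) by metis
    qed
  qed
  moreover have "?f ` (carrier K \<times> ?Z) \<subseteq> {y \<in> carrier L. lie_bracket L x y = \<zero>\<^bsub>L\<^esub>}"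
  proof (rule image_subsetI)
    fix p
    assume "p \<in> carrier K \<times> ?Z"
    then obtain a z where p: "p = (a, z)" and a: "a \<in> carrier K" and z: "z \<in> ?Z"
      by (rule SigmaE)
    have zL: "z \<in> carrier L"
      using z S.subset by (rule set_mp[rotated])
    have "lie_bracket L z x = \<zero>\<^bsub>L\<^esub>"
      using z x(1) unfolding lie_center_def by blast
    then have xz: "lie_bracket L x z = \<zero>\<^bsub>L\<^esub>"
      by (rule bracket_eq_zero_commute[OF zL x(1)])
    have "a \<odot>\<^bsub>L\<^esub> x \<oplus>\<^bsub>L\<^esub> z \<in> carrier L"
      using a x(1) zL by simp
    moreover have "lie_bracket L x (a \<odot>\<^bsub>L\<^esub> x \<oplus>\<^bsub>L\<^esub> z) = \<zero>\<^bsub>L\<^esub>"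
      using a x(1) zL xz by (simp add: bracket_add_right bracket_smult_right bracket_self)
    ultimately show "?f p \<in> {y \<in> carrier L. lie_bracket L x y = \<zero>\<^bsub>L\<^esub>}"
      by (simp add: p)
  qed
  ultimately have "card (carrier K \<times> ?Z) \<le> card {y \<in> carrier L. lie_bracket L x y = \<zero>\<^bsub>L\<^esub>}"
    using fin by (intro card_inj_on_le) auto
  then show ?thesis
    by (simp add: card_cartesian_product)
qed

text \<open>The set of pairs is fibred over the first component and the sum of the fibre sizes is
  split at \<open>Z\<close>. The subtraction of natural numbers is not truncated, since
  \<open>Z\<close> is contained in the carrier.\<close>

lemma card_commuting_pairs_ge:
  assumes fin: "finite (carrier L)"
  defines "Z \<equiv> lie_center L"
  shows "card Z * card (carrier L)
      + (card (carrier L) - card Z) * (card (carrier K) * card Z)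
    \<le> card {(x, y) \<in> carrier L \<times> carrier L. lie_bracket L x y = \<zero>\<^bsub>L\<^esub>}"
proof -
  let ?C = "\<lambda>x. {y \<in> carrier L. lie_bracket L x y = \<zero>\<^bsub>L\<^esub>}"
  have Z: "Z \<subseteq> carrier L" "finite Z"
    using fin by (auto simp: Z_def lie_center_def intro: finite_subset)
  have "card {(x, y) \<in> carrier L \<times> carrier L. lie_bracket L x y = \<zero>\<^bsub>L\<^esub>}
      = card (SIGMA x:carrier L. ?C x)"
    by (rule arg_cong[where f = card]) auto
  also have "\<dots> = (\<Sum>x\<in>carrier L. card (?C x))"
    using fin by simp
  also have "\<dots> = (\<Sum>x\<in>carrier L - Z. card (?C x)) + (\<Sum>x\<in>Z. card (?C x))"
    using fin Z by (intro sum.subset_diff) auto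
  also have "(\<Sum>x\<in>Z. card (?C x)) = card Z * card (carrier L)"
  proof -
    have "?C x = carrier L" if "x \<in> Z" for x
      using that by (auto simp: Z_def lie_center_def)
    then show ?thesis by simp
  qed
  finally have "card {(x, y) \<in> carrier L \<times> carrier L. lie_bracket L x y = \<zero>\<^bsub>L\<^esub>}
      = (\<Sum>x\<in>carrier L - Z. card (?C x)) + card Z * card (carrier L)" .
  moreover have "(\<Sum>x\<in>carrier L - Z. card (carrier K) * card Z)
      \<le> (\<Sum>x\<in>carrier L - Z. card (?C x))"
    using card_centralizer_ge[OF fin] by (intro sum_mono) (auto simp: Z_def)
  ultimately show ?thesis
    using Z by (simp add: card_Diff_subset)
qed

end

theorem theorem4p5:
  fixes K :: "('a, 'm) ring_scheme"
    and L :: "('a, 'b, 'n) lie_alg_scheme"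
    and q t :: nat
  assumes "lie_algebra K L"
    and "finite (carrier K)"
    and "card (carrier K) = q"
    and "vectorspace.fin_dim K L"
    and "\<not> lie_abelian L"
    and "vectorspace.dim K (quotient_space L (lie_center L)) = t"
  shows "commutativity_degree L
    \<ge> 1 / real q ^ t + 1 / real q ^ (t - 1) - 1 / real q ^ (2 * t - 1)"
proof -
  interpret lie_algebra K L by fact
  interpret S: subspace K "lie_center L" L by (rule subspace_lie_center)
  let ?Z = "lie_center L"
  define P where "P = {(x, y) \<in> carrier L \<times> carrier L. lie_bracket L x y = \<zero>\<^bsub>L\<^esub>}"
  have fin: "finite (carrier L)"
    using finite_carrier_if_fin_dim assms by blast
  have card_L: "card (carrier L) = card ?Z * q ^ t"
    using S.card_carrier_eq_card_mult_power_dim assms by simp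
  have "?Z \<noteq> carrier L"
    using assms(5) by (auto simp: lie_abelian_def lie_center_def)
  then have "?Z \<subset> carrier L"
    by (auto simp: lie_center_def)
  then have less: "card ?Z < card (carrier L)"
    using fin by (simp add: psubset_card_mono)
  \<comment> \<open>For t = 0 the center would have as many elements as the algebra. Since t is
    positive, the exponents t - 1 and 2 t - 1 are genuine differences.\<close>
  obtain s where t: "t = Suc s"
    using less card_L by (cases t) auto
  \<comment> \<open>If q or the size of the center were 0, then so would be the size of the algebra,
    as t is positive; this contradicts \<open>less\<close>.\<close>
  have pos: "real q > 0" "real (card ?Z) > 0"
    using less card_L t by (auto intro: gr0I)
  have "real (card P)
      \<ge> real (card ?Z * card (carrier L) + (card (carrier L) - card ?Z) * (q * card ?Z))"
    using card_commuting_pairs_ge[OF fin] assms(3) unfolding P_def by (intro of_nat_mono) simp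
  also have "real (card ?Z * card (carrier L) + (card (carrier L) - card ?Z) * (q * card ?Z))
      = real (card ?Z) ^ 2 * (real q ^ t + (real q ^ t - 1) * real q)"
  proof -
    have L: "real (card (carrier L)) = real (card ?Z) * real q ^ t"
      by (simp add: card_L)
    have "real (card (carrier L) - card ?Z) = real (card (carrier L)) - real (card ?Z)"
      using less by (simp only: of_nat_diff less_imp_le)
    then show ?thesis
      by (simp only: of_nat_add of_nat_mult L) (simp add: algebra_simps power2_eq_square)
  qed
  finally have "commutativity_degree L
      \<ge> real (card ?Z) ^ 2 * (real q ^ t + (real q ^ t - 1) * real q) / real (card (carrier L)) ^ 2"
    unfolding commutativity_degree_def P_def by (intro divide_right_mono) auto
  \<comment> \<open>The size of the center cancels, because the square of the size of the algebra
    contains the factor |Z|^2 as well.\<close>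
  also have "real (card ?Z) ^ 2 * (real q ^ t + (real q ^ t - 1) * real q) / real (card (carrier L)) ^ 2
      = (real q ^ t + (real q ^ t - 1) * real q) / (real q ^ t) ^ 2"
    using pos by (simp add: card_L power_mult_distrib)
  \<comment> \<open>The numerator is q^t + q^(t+1) - q; each term is divided by q^(2t).\<close>
  also have "\<dots> = 1 / real q ^ t + 1 / real q ^ (t - 1) - 1 / real q ^ (2 * t - 1)"
    using pos by (simp add: t field_simps power2_eq_square power_mult power_mult_distrib)
  finally show ?thesis .
qed

end
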